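(* Let $\Gamma$ be a graph with bounded degrees of vertices, $o$ a vertex of $\Gamma$, and $\nu(n)$ the number of reduced paths of length at most $n$ in $\Gamma$ starting and terminating at $o$. Then there is a finite limit $\lim_{n\to\infty}\sqrt[n]{\nu(n)}$. If $\Gamma$ is connected, this limit does not depend on the choice of $o$.
   Context: Graphs are (possibly infinite, loops and multiple edges allowed) in the sense of combinatorial group theory: every oriented edge $e$ has an initial vertex $e_-$, a terminal vertex $e_+$, and a unique inverse edge $e^{-1}\ne e$ with $(e^{-1})^{-1}=e$ and $(e^{-1})_-=e_+$. The degree of a vertex is the number of oriented edges starting at it; "bounded degrees" means that these numbers are bounded by one common finite constant. A path of length $k$ is a sequence $p=e_1\dots e_k$ of oriented edges with $(e_{i-1})_+=(e_i)_-$ for $i=2,\dots,k$; it is called reduced if $e_i\ne e_{i-1}^{-1}$ for $i=2,\dots,k$. The trivial path of length $0$ at $o$ is counted as a reduced path. *)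

theory Defs
  imports
    Complex_Main
    "Graph_Theory.Digraph_Component"
    "Graph_Theory.Bidirected_Digraph"
begin

text \<open>
  A graph in the sense of combinatorial group theory is a \<open>bidirected_digraph G arev\<close>: the
  elements of \<open>arcs G\<close> are the oriented edges, \<open>tail G e\<close> and \<open>head G e\<close> are the initial and
  terminal vertices, and \<open>arev e\<close> is the inverse edge. The locale allows infinitely many vertices
  and edges, loops and multiple edges. It also requires that \<open>arev\<close> is the identity outside
  \<open>arcs G\<close>, which only fixes irrelevant values. Paths are the library's \<open>awalk\<close>s.
\<close>

text \<open>
  \<open>out_degree\<close> is a cardinality in \<open>nat\<close>, hence \<open>0\<close> at a vertex of infinite degree; finiteness
  must be required separately.
\<close>

definition bounded_degrees :: "('a, 'b) pre_digraph \<Rightarrow> bool" where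
  "bounded_degrees G \<longleftrightarrow>
     (\<exists>d::nat. \<forall>v \<in> verts G. finite (out_arcs G v) \<and> out_degree G v \<le> d)"

definition reduced :: "('b \<Rightarrow> 'b) \<Rightarrow> 'b list \<Rightarrow> bool" where
  "reduced arev p \<longleftrightarrow> (\<forall>i. Suc i < length p \<longrightarrow> p ! Suc i \<noteq> arev (p ! i))"

definition reduced_closed_paths ::
  "('a, 'b) pre_digraph \<Rightarrow> ('b \<Rightarrow> 'b) \<Rightarrow> 'a \<Rightarrow> nat \<Rightarrow> 'b list set" where
  "reduced_closed_paths G arev v n =
     {p. pre_digraph.awalk G v p v \<and> reduced arev p \<and> length p \<le> n}"

text \<open>The set counted here is finite whenever the degrees are bounded.\<close>

definition \<nu> :: "('a, 'b) pre_digraph \<Rightarrow> ('b \<Rightarrow> 'b) \<Rightarrow> 'a \<Rightarrow> nat \<Rightarrow> nat" where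
  "\<nu> G arev v n = card (reduced_closed_paths G arev v n)"

end

theory Submission
  imports Defs "HOL-Real_Asymp.Real_Asymp"
begin

text \<open>
  The obstacle to a direct application of Fekete's lemma is that the product of two reduced closed
  paths at a vertex need not be reduced. This difficulty disappears when paths are glued along a
  common arc instead: the number \<open>a k\<close> of reduced paths with \<open>k\<close> turns that start and end with the
  same arc \<open>f\<close> satisfies \<open>a m * a n \<le> a (m + n)\<close>. As \<open>a k\<close> is at most exponential by the bound on
  the degrees, the roots of its partial sums converge (\<open>supermultiplicative_sum_root_limit\<close>).

  It remains to compare these partial sums with \<open>\<nu>\<close>, up to a constant factor and a constant change
  of the length, which do not affect the limit of the roots (\<open>root_limit_transfer\<close>). Conjugation
  along an arc shows that \<open>\<nu>\<close> at its two ends is comparable in this sense. This proves that the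
  limit is the same for all vertices of a component, and it allows one to move the base vertex. If
  there is any nontrivial reduced closed path, one can move to a vertex on a cyclically reduced one;
  let \<open>e\<close> be its first and \<open>f\<close> its last arc. Each reduced closed path at that vertex can be extended
  by one arc at either end, taken from the cyclically reduced path or its inverse
  (\<open>reduced_closed_path_extends\<close>), and then completed to a loop at \<open>f\<close> by boundedly many arcs. The
  completion needs an argument when the extended path begins along the cyclically reduced path in
  one direction and ends along it in the other direction. One then has to turn round once more,
  which is possible by \<open>turns_can_reverse_back\<close>: otherwise the arcs that are mutually accessible
  with \<open>f\<close> would form a single cycle with no way to turn round in the first place.
\<close>

section \<open>Growth of sequences\<close>

text \<open>
  Counts of paths are compared only up to a constant factor and a constant change of the admitted
  length, which is invisible to the \<open>n\<close>-th root.
\<close>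

definition dominated :: "(nat \<Rightarrow> nat) \<Rightarrow> (nat \<Rightarrow> nat) \<Rightarrow> bool" where
  "dominated a b \<longleftrightarrow> (\<exists>C K. \<forall>n. a n \<le> C * b (n + K))"

lemma dominatedI: "(\<And>n. a n \<le> C * b (n + K)) \<Longrightarrow> dominated a b"
  unfolding dominated_def by blast

lemma dominated_refl: "dominated a a"
  by (rule dominatedI[where C = 1 and K = 0]) simp

lemma dominated_trans:
  assumes "dominated a b" "dominated b c"
  shows "dominated a c"
proof -
  obtain C K where ab: "\<And>n. a n \<le> C * b (n + K)"
    using assms(1) unfolding dominated_def by blast
  obtain D M where bc: "\<And>n. b n \<le> D * c (n + M)"
    using assms(2) unfolding dominated_def by blast
  have "a n \<le> C * D * c (n + (K + M))" for n
    using order_trans[OF ab[of n] mult_le_mono2[OF bc[of "n + K"], of C]]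
    by (simp add: ac_simps)
  then show ?thesis by (rule dominatedI)
qed

text \<open>
  With \<open>r\<^sub>m\<close> the \<open>m\<close>-th root of \<open>b m\<close>, the \<open>(n + i)\<close>-th root of \<open>C * b (n + j)\<close> is
  \<open>C\<close> to the power \<open>1 / (n + i)\<close> times \<open>r\<^sub>n\<^sub>+\<^sub>j\<close> to the power \<open>(n + j) / (n + i)\<close>. These exponents
  tend to \<open>0\<close> and \<open>1\<close>.
\<close>

lemma root_shift_tendsto:
  fixes b :: "nat \<Rightarrow> nat" and C L :: real
  assumes lim: "(\<lambda>n. root n (b n)) \<longlonglongrightarrow> L"
    and pos: "\<And>n. b n \<ge> 1" and C: "C > 0"
  shows "(\<lambda>n. root (n + i) (C * b (n + j))) \<longlonglongrightarrow> L"
proof -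
  have "L \<ge> 1"
  proof (rule LIMSEQ_le_const[OF lim], intro exI allI impI)
    fix n :: nat assume "1 \<le> n"
    then show "1 \<le> root n (b n)" using pos[of n] by simp
  qed
  have exps: "(\<lambda>n. 1 / real (n + i)) \<longlonglongrightarrow> 0"
    "(\<lambda>n. real (n + j) / real (n + i)) \<longlonglongrightarrow> 1" by real_asymp+
  have "(\<lambda>n. C powr (1 / real (n + i)) *
             root (n + j) (b (n + j)) powr (real (n + j) / real (n + i)))
        \<longlonglongrightarrow> C powr 0 * L powr 1"
    using \<open>L \<ge> 1\<close> C LIMSEQ_ignore_initial_segment[OF lim, of j]
    by (intro tendsto_mult tendsto_powr exps tendsto_const) auto
  moreover have "\<forall>\<^sub>F n in sequentially.
      C powr (1 / real (n + i)) *
        root (n + j) (b (n + j)) powr (real (n + j) / real (n + i))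
      = root (n + i) (C * b (n + j))"
    using eventually_gt_at_top[of 0]
  proof eventually_elim
    case (elim n)
    have "real (b (n + j)) > 0" using pos[of "n + j"] by simp
    with elim C show ?case
      by (simp add: root_powr_inverse powr_powr powr_mult)
  qed
  ultimately show ?thesis using C \<open>L \<ge> 1\<close> by (simp add: tendsto_cong)
qed

text \<open>
  The shifted sequence \<open>a (n + M)\<close> lies between \<open>b n / D\<close> and \<open>C * b (n + M + K)\<close>; shifting first
  avoids a truncated subtraction in the lower bound.
\<close>

lemma root_limit_transfer:
  fixes a b :: "nat \<Rightarrow> nat" and L :: real
  assumes lim: "(\<lambda>n. root n (b n)) \<longlonglongrightarrow> L"
    and pos: "\<And>n. b n \<ge> 1"
    and ab: "dominated a b" and ba: "dominated b a"
  shows "(\<lambda>n. root n (a n)) \<longlonglongrightarrow> L"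
proof -
  obtain C K where up: "\<And>n. a n \<le> C * b (n + K)"
    using ab unfolding dominated_def by blast
  obtain D M where low: "\<And>n. b n \<le> D * a (n + M)"
    using ba unfolding dominated_def by blast
  have D: "D > 0" using low[of 0] pos[of 0] by (cases D) auto
  have C: "C > 0"
    using up[of M] low[of 0] pos[of 0] by (cases C) auto
  have "(\<lambda>n. root (n + M) (a (n + M))) \<longlonglongrightarrow> L"
  proof (rule tendsto_sandwich)
    show "(\<lambda>n. root (n + M) (inverse (real D) * b (n + 0))) \<longlonglongrightarrow> L"
      using D by (intro root_shift_tendsto[OF lim pos]) auto
    show "(\<lambda>n. root (n + M) (real C * b (n + (M + K)))) \<longlonglongrightarrow> L"
      using C by (intro root_shift_tendsto[OF lim pos]) auto
    show "\<forall>\<^sub>F n in sequentially.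
        root (n + M) (inverse (real D) * b (n + 0)) \<le> root (n + M) (a (n + M))"
      using eventually_gt_at_top[of 0]
    proof eventually_elim
      case (elim n)
      have "real (b n) \<le> real D * real (a (n + M))"
        using low[of n] by (metis of_nat_le_iff of_nat_mult)
      with D have "inverse (real D) * b n \<le> a (n + M)" by (simp add: field_simps)
      with elim show ?case by simp
    qed
    show "\<forall>\<^sub>F n in sequentially.
        root (n + M) (a (n + M)) \<le> root (n + M) (real C * b (n + (M + K)))"
      using eventually_gt_at_top[of 0]
    proof eventually_elim
      case (elim n)
      have "real (a (n + M)) \<le> real C * b (n + (M + K))"
        using up[of "n + M"] by (metis add.assoc of_nat_le_iff of_nat_mult)
      with elim show ?case by simp
    qed
  qed
  then show ?thesis by (rule LIMSEQ_offset)
qed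

lemma supermultiplicative_power:
  fixes a :: "nat \<Rightarrow> nat"
  assumes "a 0 = 1" and "\<And>m n. a m * a n \<le> a (m + n)"
  shows "a k ^ q \<le> a (k * q)"
proof (induction q)
  case (Suc q)
  have "a k ^ Suc q \<le> a k * a (k * q)" using Suc by simp
  also have "\<dots> \<le> a (k * Suc q)" using assms(2)[of k "k * q"] by simp
  finally show ?case .
qed (simp add: assms)

text \<open>
  A variant of Fekete's lemma. Unlike \<open>a\<close> itself, which may vanish outside the multiples of a
  period, its partial sums \<open>A n\<close> do have convergent roots, with limit
  \<open>L = max 1 (SUP k\<ge>1. root k (a k))\<close>. Indeed \<open>a k \<le> L ^ k\<close> gives \<open>A n \<le> (n + 1) * L ^ n\<close>, while
  \<open>A n \<ge> a (k * (n div k)) \<ge> a k ^ (n div k)\<close> shows that no single \<open>root k (a k)\<close> exceeds the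
  lower limit.
\<close>

lemma supermultiplicative_sum_root_limit:
  fixes a :: "nat \<Rightarrow> nat"
  assumes a0: "a 0 = 1" and super: "\<And>m n. a m * a n \<le> a (m + n)"
    and bound: "\<And>n. a n \<le> D ^ n"
  shows "\<exists>L::real. (\<lambda>n. root n (real (\<Sum>k\<le>n. a k))) \<longlonglongrightarrow> L"
proof -
  define X where "X = insert 1 ((\<lambda>k. root k (a k)) ` {1..})"
  define L where "L = Sup X"
  define A where "A n = (\<Sum>k\<le>n. a k)" for n
  have "root k (a k) \<le> D" if "k \<ge> 1" for k
  proof -
    have "root k (a k) \<le> root k (real D ^ k)"
      using bound[of k] that by (simp flip: of_nat_power)
    also have "\<dots> = D" using that by (simp add: real_root_power_cancel)
    finally show ?thesis .
  qed
  then have "bdd_above ((\<lambda>k. root k (a k)) ` {1..})"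
    by (intro bdd_aboveI2[where M = "real D"]) auto
  then have bdd: "bdd_above X" by (simp add: X_def)
  have "L \<ge> 1" unfolding L_def by (rule cSup_upper[OF _ bdd]) (simp add: X_def)
  have aL: "a k \<le> L ^ k" for k
  proof (cases "k = 0")
    case False
    then have "root k (a k) \<le> L"
      unfolding L_def by (intro cSup_upper[OF _ bdd]) (auto simp: X_def)
    then have "root k (a k) ^ k \<le> L ^ k" by (intro power_mono real_root_ge_zero) auto
    with False show ?thesis by simp
  qed (simp add: a0)
  have mem: "a k \<le> A n" if "k \<le> n" for k n
    unfolding A_def using that by (intro member_le_sum) auto
  have A1: "A n \<ge> 1" for n using mem[of 0 n] a0 by simp
  have upper: "A n \<le> real (Suc n) * L ^ n" for n
  proof -
    have "real (A n) \<le> (\<Sum>k\<le>n. L ^ n)"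
      unfolding A_def of_nat_sum
      using \<open>L \<ge> 1\<close> by (intro sum_mono order_trans[OF aL] power_increasing) auto
    then show ?thesis by simp
  qed
  have "(\<lambda>n. root n (A n)) \<longlonglongrightarrow> L"
  proof (rule order_tendstoI)
    fix y assume "y < L"
    then obtain x where x: "x \<in> X" "y < x"
      unfolding L_def using less_cSup_iff[OF _ bdd, of y] by (auto simp: X_def)
    show "\<forall>\<^sub>F n in sequentially. y < root n (A n)"
    proof (cases "x \<le> 1")
      case True
      show ?thesis using eventually_gt_at_top[of 0]
      proof eventually_elim
        case (elim n)
        then have "1 \<le> root n (A n)" using A1[of n] by simp
        with True x show ?case by linarith
      qed
    next
      case False
      with x obtain k where k: "k \<ge> 1" "x = root k (a k)" by (auto simp: X_def)
      have ak: "real (a k) = x ^ k" using k by simp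
      have "(\<lambda>n. x powr (1 - k / n)) \<longlonglongrightarrow> x powr (1 - 0)"
        using False by (intro tendsto_intros lim_const_over_n) auto
      then have "\<forall>\<^sub>F n in sequentially. y < x powr (1 - k / n)"
        using False x by (intro order_tendstoD(1)) auto
      then show ?thesis using eventually_ge_at_top[of k]
      proof eventually_elim
        case (elim n)
        have "x ^ (n - k) \<le> x ^ (k * (n div k))"
          using False k mod_less_divisor[of k n] mult_div_mod_eq[of k n]
          by (intro power_increasing) linarith+
        also have "\<dots> = a k ^ (n div k)" by (simp add: ak power_mult)
        also have "\<dots> \<le> A n"
          using order_trans[OF supermultiplicative_power[OF a0 super, of k "n div k"] mem]
          by simp
        finally have "root n (x ^ (n - k)) \<le> root n (A n)"
          using elim k by simp
        moreover have "root n (x ^ (n - k)) = x powr (1 - k / n)"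
        proof -
          have "n > 0" "x > 0" using elim k(1) False by auto
          moreover have "x ^ (n - k) = x powr (real n - real k)"
            using elim \<open>x > 0\<close> by (simp add: of_nat_diff flip: powr_realpow)
          ultimately show ?thesis
            by (simp add: root_powr_inverse powr_powr diff_divide_distrib)
        qed
        ultimately show ?case using elim by linarith
      qed
    qed
  next
    fix y assume "L < y"
    have "(\<lambda>n. root n (real (Suc n)) * L) \<longlonglongrightarrow> 1 * L"
    proof (intro tendsto_mult tendsto_const)
      show "(\<lambda>n. root n (real (Suc n))) \<longlonglongrightarrow> 1"
      proof (rule Lim_transform_eventually)
        show "(\<lambda>n. real (Suc n) powr (1 / real n)) \<longlonglongrightarrow> 1" by real_asymp
        show "\<forall>\<^sub>F n in sequentially. real (Suc n) powr (1 / real n) = root n (real (Suc n))"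
          using eventually_gt_at_top[of 0]
          by eventually_elim (simp add: root_powr_inverse)
      qed
    qed
    then have "\<forall>\<^sub>F n in sequentially. root n (real (Suc n)) * L < y"
      using \<open>L < y\<close> by (intro order_tendstoD(2)) auto
    then show "\<forall>\<^sub>F n in sequentially. root n (A n) < y"
      using eventually_gt_at_top[of 0]
    proof eventually_elim
      case (elim n)
      have "root n (A n) \<le> root n (real (Suc n) * L ^ n)"
        using upper elim by simp
      also have "\<dots> = root n (real (Suc n)) * L"
        using elim \<open>L \<ge> 1\<close> by (simp add: real_root_mult real_root_power_cancel)
      finally show ?case using elim by linarith
    qed
  qed
  then show ?thesis unfolding A_def by blast
qed
section \<open>Turns and routes between arcs\<close>

lemma card_mult_le_by_injection:
  assumes "inj_on f (A \<times> B)" and "f ` (A \<times> B) \<subseteq> C" and "finite C"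
  shows "card A * card B \<le> card C"
  using card_inj_on_le[OF assms] by (simp add: card_cartesian_product)

context bidirected_digraph
begin

text \<open>
  Reduced paths are the walks of the relation \<open>turn\<close> on arcs. Two of them that end and start with
  the same arc can be glued along it without any cancellation; gluing at a common vertex would not
  preserve reducedness.
\<close>

definition turn :: "'b \<Rightarrow> 'b \<Rightarrow> bool" where
  "turn e f \<longleftrightarrow> e \<in> arcs G \<and> f \<in> arcs G \<and> head G e = tail G f \<and> f \<noteq> arev e"

lemma turn_arev: "turn e f \<Longrightarrow> turn (arev f) (arev e)"
  unfolding turn_def by auto

lemma turns_arev: "turn\<^sup>*\<^sup>* e f \<Longrightarrow> turn\<^sup>*\<^sup>* (arev f) (arev e)"
  by (induction rule: rtranclp_induct) (auto intro: turn_arev converse_rtranclp_into_rtranclp)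

lemma turns_arev_iff: "turn\<^sup>*\<^sup>* (arev f) (arev e) \<longleftrightarrow> turn\<^sup>*\<^sup>* e f"
  using turns_arev[of e f] turns_arev[of "arev f" "arev e"] by auto

text \<open>
  If a recurrent arc \<open>e\<close> can be traversed and later traversed backwards, then the same is possible
  with the orientations exchanged.

  Suppose not, and let \<open>F\<close> be the strongly connected component of \<open>e\<close> for \<open>turn\<close>; the inverses of
  arcs of \<open>F\<close> form the component of \<open>arev e\<close>. Two distinct arcs \<open>h\<close> and \<open>h'\<close> of \<open>F\<close> with the
  same tail would give the turn from \<open>arev h\<close> to \<open>h'\<close> and hence the forbidden passage from
  \<open>arev e\<close> to \<open>e\<close>. So every arc of \<open>F\<close> has a unique successor in \<open>F\<close>, that is, \<open>F\<close> is a single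
  cycle. But where a path from \<open>e\<close> to \<open>arev e\<close> leaves \<open>F\<close> by an arc \<open>g\<close>, the arc \<open>arev g\<close> turns
  out to lie in \<open>F\<close>, so that two arcs of the cycle have a common head and hence a common successor:
  they coincide, and the path would have backtracked.
\<close>

lemma turns_can_reverse_back:
  assumes rec: "turn\<^sup>+\<^sup>+ e e" and rev: "turn\<^sup>*\<^sup>* e (arev e)"
  shows "turn\<^sup>*\<^sup>* (arev e) e"
proof (rule ccontr)
  assume no: "\<not> turn\<^sup>*\<^sup>* (arev e) e"
  define F where "F = {f. turn\<^sup>*\<^sup>* e f \<and> turn\<^sup>*\<^sup>* f e}"
  have eF: "e \<in> F" by (simp add: F_def)
  have arev_F: "turn\<^sup>*\<^sup>* (arev e) (arev f)" if "f \<in> F" for f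
    using that by (auto simp: F_def turns_arev_iff)
  have same_tail: "h = h'" if "h \<in> F" "h' \<in> F" "tail G h = tail G h'"
    "h \<in> arcs G" "h' \<in> arcs G" for h h'
  proof (rule ccontr)
    assume "h \<noteq> h'"
    with that have "turn (arev h) h'" by (auto simp: turn_def)
    with that arev_F[of h] have "turn\<^sup>*\<^sup>* (arev e) h'"
      by (blast intro: rtranclp.rtrancl_into_rtrancl)
    with \<open>h' \<in> F\<close> no show False unfolding F_def by (blast intro: rtranclp_trans)
  qed
  have succ: "\<exists>h \<in> F. turn f h" if f: "f \<in> F" for f
  proof -
    have "turn\<^sup>+\<^sup>+ f e" using f rec by (auto simp: F_def)
    then obtain h where "turn f h" "turn\<^sup>*\<^sup>* h e" by (meson tranclpD)
    with f show ?thesis by (auto simp: F_def intro: rtranclp.rtrancl_into_rtrancl)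
  qed
  \<comment> \<open>A path from \<open>e\<close> to \<open>arev e\<close> has to leave \<open>F\<close> somewhere.\<close>
  have "\<exists>f g. f \<in> F \<and> g \<notin> F \<and> turn f g \<and> turn\<^sup>*\<^sup>* g (arev e)"
  proof -
    have "x \<in> F \<Longrightarrow> ?thesis" if "turn\<^sup>*\<^sup>* x (arev e)" for x
      using that
    proof (induction rule: converse_rtranclp_induct)
      case base
      with no show ?case by (simp add: F_def)
    qed blast
    with eF rev show ?thesis by blast
  qed
  then obtain f g where fg: "f \<in> F" "g \<notin> F" "turn f g" "turn\<^sup>*\<^sup>* g (arev e)" by blast
  obtain h where h: "h \<in> F" "turn f h" using succ fg(1) by blast
  \<comment> \<open>Going back along the successor \<open>h\<close> of \<open>f\<close> in \<open>F\<close>, one can turn off into \<open>g\<close>.\<close>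
  have "turn (arev h) g"
    using fg h by (auto simp: turn_def)
  then have "turn\<^sup>*\<^sup>* (arev e) g" using arev_F[OF h(1)] by simp
  then have gF: "arev g \<in> F"
    using fg(4) by (metis (mono_tags) F_def arev_arev mem_Collect_eq turns_arev_iff)
  define next_arc where "next_arc f = (SOME h. h \<in> F \<and> turn f h)" for f
  have next_arc: "next_arc f \<in> F" "turn f (next_arc f)" if "f \<in> F" for f
    using someI_ex[of "\<lambda>h. h \<in> F \<and> turn f h"] succ[OF that] unfolding next_arc_def by blast+
  have next_unique: "h = next_arc f" if "f \<in> F" "h \<in> F" "turn f h" for f h
    using that next_arc[OF that(1)] by (intro same_tail) (auto simp: turn_def)
  have iterates: "\<exists>n. y = (next_arc ^^ n) x" if "turn\<^sup>*\<^sup>* x y" "x \<in> F" "y \<in> F" for x y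
    using that
  proof (induction rule: rtranclp_induct)
    case base
    show ?case by (rule exI[of _ 0]) simp
  next
    case (step y z)
    have "y \<in> F"
      using step.hyps step.prems by (auto simp: F_def intro: converse_rtranclp_into_rtranclp rtranclp_trans)
    with step obtain n where "y = (next_arc ^^ n) x" by blast
    moreover have "z = next_arc y" using step \<open>y \<in> F\<close> next_unique by blast
    ultimately have "z = (next_arc ^^ Suc n) x" by simp
    then show ?case by blast
  qed
  have reach: "turn\<^sup>*\<^sup>* x y" if "x \<in> F" "y \<in> F" for x y
    using that by (auto simp: F_def)
  define f' where "f' = arev g"
  have same_next: "next_arc f = next_arc f'"
  proof (rule same_tail)
    have "head G f = head G f'" using fg(3) by (simp add: f'_def turn_def)
    then show "tail G (next_arc f) = tail G (next_arc f')"
      using next_arc[OF fg(1)] next_arc(2)[of f'] gF by (simp add: f'_def turn_def)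
  qed (use next_arc[OF fg(1)] next_arc[of f'] gF in \<open>auto simp: f'_def turn_def\<close>)
  have same_iterate: "(next_arc ^^ Suc k) f = (next_arc ^^ Suc k) f'" for k
    using same_next by (simp only: funpow_Suc_right comp_apply)
  have periodic: "\<exists>n. (next_arc ^^ Suc n) x = x" if x: "x \<in> F" for x
  proof -
    obtain n where "x = (next_arc ^^ n) (next_arc x)"
      using iterates reach x next_arc(1) by meson
    then show ?thesis by (metis funpow_Suc_right comp_apply)
  qed
  obtain m n where m: "(next_arc ^^ Suc m) f = f" and n: "(next_arc ^^ Suc n) f' = f'"
    using periodic fg(1) gF unfolding f'_def by meson
  \<comment> \<open>A common multiple of the two periods brings both arcs back to themselves, but they share
      all proper iterates.\<close>
  have "f = (next_arc ^^ (Suc m * Suc n)) f"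
    using m by (metis funpow_mod_eq mod_mult_self1_is_0 funpow_0)
  also have "\<dots> = (next_arc ^^ (Suc m * Suc n)) f'"
    using same_iterate[of "n + m * Suc n"] by (simp only: mult_Suc add_Suc)
  also have "\<dots> = f'"
    using n by (metis funpow_mod_eq mod_mult_self2_is_0 funpow_0)
  finally have "g = arev f" by (simp add: f'_def)
  with fg(3) show False by (simp add: turn_def)
qed

text \<open>
  The index counts turns, so that gluing along a common arc adds indices; a route has one more arc
  than turns.
\<close>

definition routes :: "'b \<Rightarrow> 'b \<Rightarrow> nat \<Rightarrow> 'b list set" where
  "routes e f n = {p. length p = Suc n \<and> hd p = e \<and> last p = f \<and>
     set p \<subseteq> arcs G \<and> successively turn p}"

lemma routesD:
  assumes "p \<in> routes e f n"
  shows "p \<noteq> []" "p = e # tl p" "hd p = e" "last p = f" "length p = Suc n"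
    "set p \<subseteq> arcs G" "successively turn p"
  using assms by (cases p; auto simp: routes_def)+

lemma routes_0: "e \<in> arcs G \<Longrightarrow> routes e e 0 = {[e]}"
  by (auto simp: routes_def length_Suc_conv)

lemma routes_reachable: "p \<in> routes e f n \<Longrightarrow> turn\<^sup>*\<^sup>* e f"
proof (induction n arbitrary: e p)
  case 0
  then show ?case by (auto simp: routes_def length_Suc_conv)
next
  case (Suc n)
  then obtain e' q where "p = e # e' # q" by (auto simp: routes_def length_Suc_conv)
  with Suc.prems have "turn e e'" "e' # q \<in> routes e' f n" by (auto simp: routes_def)
  then show ?case using Suc.IH by (blast intro: converse_rtranclp_into_rtranclp)
qed

lemma reachable_routes:
  assumes "turn\<^sup>*\<^sup>* e f" and "f \<in> arcs G"
  shows "\<exists>n. routes e f n \<noteq> {}"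
  using assms(1)
proof (induction rule: converse_rtranclp_induct)
  case base
  with assms(2) routes_0 show ?case by blast
next
  case (step e e')
  then obtain n p where p: "p \<in> routes e' f n" by blast
  have "e # p \<in> routes e f (Suc n)"
    using routesD[OF p] step.hyps(1) by (auto simp: routes_def successively_Cons turn_def)
  then show ?case by blast
qed

lemma routes_rev:
  assumes "p \<in> routes e f n"
  shows "map arev (rev p) \<in> routes (arev f) (arev e) n"
proof -
  have "successively turn p" "p \<noteq> []" using routesD[OF assms] by auto
  then have "successively (\<lambda>e f. turn (arev f) (arev e)) p"
    by (auto intro: successively_mono turn_arev)
  with routesD[OF assms] show ?thesis
    by (auto simp: routes_def successively_map successively_rev hd_map hd_rev last_map last_rev)
qed

lemma routes_join:
  assumes "p \<in> routes e f m" and "q \<in> routes f g n"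
  shows "p @ tl q \<in> routes e g (m + n)"
proof (cases "tl q")
  case Nil
  with assms show ?thesis by (cases q) (auto simp: routes_def)
next
  case (Cons x q')
  with routesD(2)[OF assms(2)] have "q = f # x # q'" by simp
  with assms show ?thesis by (auto simp: routes_def successively_append_iff hd_append)
qed

section \<open>Reduced paths between vertices\<close>

lemma reduced_iff_successively: "reduced arev p \<longleftrightarrow> successively (\<lambda>e f. f \<noteq> arev e) p"
  by (auto simp: reduced_def successively_conv_nth)

lemma reduced_awalk_iff_turns:
  assumes "p \<noteq> []"
  shows "awalk u p w \<and> reduced arev p \<longleftrightarrow>
    set p \<subseteq> arcs G \<and> successively turn p \<and> tail G (hd p) = u \<and> head G (last p) = w"
  using assms
proof (induction p arbitrary: u rule: list_nonempty_induct)
  case (single e)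
  then show ?case by (auto simp: awalk_simps reduced_iff_successively)
next
  case (cons e p)
  have "awalk u (e # p) w \<and> reduced arev (e # p) \<longleftrightarrow>
      e \<in> arcs G \<and> tail G e = u \<and> hd p \<noteq> arev e \<and> awalk (head G e) p w \<and> reduced arev p"
    using cons.hyps
    by (auto simp: awalk_Cons_iff reduced_iff_successively successively_Cons)
  with cons.hyps cons.IH[of "head G e"] hd_in_set[of p] show ?case
    by (auto simp: successively_Cons turn_def[of e])
qed

definition reduced_paths :: "'a \<Rightarrow> 'a \<Rightarrow> nat \<Rightarrow> 'b list set" where
  "reduced_paths u w n = {p. awalk u p w \<and> reduced arev p \<and> length p \<le> n}"

lemma \<nu>_eq: "\<nu> G arev v n = card (reduced_paths v v n)"
  by (simp add: \<nu>_def reduced_closed_paths_def reduced_paths_def)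

lemma reduced_paths_rev:
  assumes "p \<in> reduced_paths u w n"
  shows "map arev (rev p) \<in> reduced_paths w u n"
proof (cases "p = []")
  case True
  with assms show ?thesis by (auto simp: reduced_paths_def awalk_Nil_iff)
next
  case False
  have p: "set p \<subseteq> arcs G" "successively turn p" "tail G (hd p) = u" "head G (last p) = w"
    using assms reduced_awalk_iff_turns[OF False] by (auto simp: reduced_paths_def)
  then have "map arev (rev p) \<in> routes (arev (last p)) (arev (hd p)) (length p - 1)"
    using False by (intro routes_rev) (simp add: routes_def)
  note r = routesD[OF this]
  have "hd p \<in> arcs G" "last p \<in> arcs G" using p(1) False by auto
  then have "tail G (hd (map arev (rev p))) = w" "head G (last (map arev (rev p))) = u"
    using r(3,4) p(3,4) by simp_all
  with r reduced_awalk_iff_turns[OF r(1)] assms show ?thesis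
    by (simp add: reduced_paths_def)
qed

text \<open>
  Multiplication by \<open>arev a\<close> on the left followed by free reduction: at most one cancellation can
  occur in front of a reduced path.
\<close>

definition push_arc :: "'b \<Rightarrow> 'b list \<Rightarrow> 'b list" where
  "push_arc a p = (if p \<noteq> [] \<and> hd p = a then tl p else arev a # p)"

lemma push_arc_inverse:
  assumes "reduced arev p"
  shows "push_arc (arev a) (push_arc a p) = p"
proof (cases p)
  case (Cons e q)
  then show ?thesis
    using assms by (cases q) (auto simp: push_arc_def reduced_iff_successively)
qed (simp add: push_arc_def)

lemma push_arc_reduced_paths:
  assumes "a \<in> arcs G" and "p \<in> reduced_paths (tail G a) w n"
  shows "push_arc a p \<in> reduced_paths (head G a) w (Suc n)"
  using assms
  by (cases p)
    (auto simp: push_arc_def reduced_paths_def awalk_simps reduced_iff_successively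
      successively_Cons)

end

section \<open>Bounded degrees\<close>

locale bounded_bidirected_digraph = bidirected_digraph G arev
    for G :: "('a, 'b) pre_digraph" and arev +
  fixes d :: nat
  assumes finite_out: "u \<in> verts G \<Longrightarrow> finite (out_arcs G u)"
    and out_degree_le: "u \<in> verts G \<Longrightarrow> card (out_arcs G u) \<le> d"
begin

definition awalks_from :: "'a \<Rightarrow> nat \<Rightarrow> 'b list set" where
  "awalks_from u n = {p. length p = n \<and> (\<exists>w. awalk u p w)}"

lemma awalks_from_Suc:
  "awalks_from u (Suc n) = (\<Union>e\<in>out_arcs G u. (#) e ` awalks_from (head G e) n)"
proof (intro equalityI subsetI)
  fix p assume "p \<in> awalks_from u (Suc n)"
  then obtain e q w where "p = e # q" "length q = n" "awalk u (e # q) w"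
    unfolding awalks_from_def by (auto simp: length_Suc_conv)
  then show "p \<in> (\<Union>e\<in>out_arcs G u. (#) e ` awalks_from (head G e) n)"
    by (intro UN_I[of e] imageI) (auto simp: awalks_from_def awalk_Cons_iff)
qed (auto simp: awalks_from_def awalk_Cons_iff)

lemma finite_card_awalks_from:
  assumes "u \<in> verts G"
  shows "finite (awalks_from u n) \<and> card (awalks_from u n) \<le> d ^ n"
  using assms
proof (induction n arbitrary: u)
  case 0
  then have "awalks_from u 0 = {[]}" by (auto simp: awalks_from_def awalk_Nil_iff)
  then show ?case by simp
next
  case (Suc n)
  have IH: "finite (awalks_from (head G e) n)" "card (awalks_from (head G e) n) \<le> d ^ n"
    if "e \<in> out_arcs G u" for e
    using Suc.IH[of "head G e"] that by auto
  have "card (awalks_from u (Suc n))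
      \<le> (\<Sum>e\<in>out_arcs G u. card ((#) e ` awalks_from (head G e) n))"
    unfolding awalks_from_Suc by (rule card_UN_le[OF finite_out[OF Suc.prems]])
  also have "\<dots> \<le> (\<Sum>e\<in>out_arcs G u. d ^ n)"
    using IH by (intro sum_mono) (simp add: card_image)
  also have "\<dots> = card (out_arcs G u) * d ^ n" by simp
  also have "\<dots> \<le> d ^ Suc n" using out_degree_le[OF Suc.prems] by simp
  finally have "card (awalks_from u (Suc n)) \<le> d ^ Suc n" .
  moreover have "finite (awalks_from u (Suc n))"
    unfolding awalks_from_Suc using IH(1) finite_out[OF Suc.prems] by blast
  ultimately show ?case by blast
qed

lemma finite_awalks:
  assumes "u \<in> verts G"
  shows "finite {p. awalk u p w \<and> length p \<le> n}"
proof (rule finite_subset)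
  show "{p. awalk u p w \<and> length p \<le> n} \<subseteq>
      (\<Union>k\<le>n. awalks_from u k)"
    unfolding awalks_from_def by blast
qed (use finite_card_awalks_from[OF assms] in blast)

lemma finite_reduced_paths: "finite (reduced_paths u w n)"
proof (cases "u \<in> verts G")
  case True
  then show ?thesis
    by (rule finite_subset[rotated, OF finite_awalks]) (auto simp: reduced_paths_def)
next
  case False
  then have "reduced_paths u w n = {}" by (auto simp: reduced_paths_def dest: awalk_hd_in_verts)
  then show ?thesis by simp
qed

lemma card_reduced_paths_swap: "card (reduced_paths u w n) \<le> card (reduced_paths w u n)"
proof (rule card_inj_on_le)
  show "inj_on (\<lambda>p. map arev (rev p)) (reduced_paths u w n)"
    by (rule inj_on_inverseI[where g = "\<lambda>p. map arev (rev p)"]) (simp add: rev_map)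
qed (use reduced_paths_rev finite_reduced_paths in blast)+

lemma card_reduced_paths_push:
  assumes "a \<in> arcs G"
  shows "card (reduced_paths (tail G a) w n) \<le> card (reduced_paths (head G a) w (Suc n))"
proof (rule card_inj_on_le)
  show "inj_on (push_arc a) (reduced_paths (tail G a) w n)"
    by (rule inj_on_inverseI[where g = "push_arc (arev a)"])
      (auto simp: reduced_paths_def push_arc_inverse)
qed (use assms push_arc_reduced_paths finite_reduced_paths in blast)+

text \<open>
  Free reduction of the conjugates by \<open>a\<close> embeds the reduced closed paths at one end of \<open>a\<close> into
  those at the other end, changing lengths by at most \<open>2\<close>. The conjugation is done one side at a
  time, with an inversion in between.
\<close>

lemma \<nu>_dominated_by_neighbour:
  assumes "a \<in> arcs G"
  shows "dominated (\<nu> G arev (tail G a)) (\<nu> G arev (head G a))"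
proof (rule dominatedI)
  fix n
  let ?u = "tail G a" and ?w = "head G a"
  have "card (reduced_paths ?u ?u n) \<le> card (reduced_paths ?w ?u (Suc n))"
    by (rule card_reduced_paths_push[OF assms])
  also have "\<dots> \<le> card (reduced_paths ?u ?w (Suc n))"
    by (rule card_reduced_paths_swap)
  also have "\<dots> \<le> card (reduced_paths ?w ?w (Suc (Suc n)))"
    by (rule card_reduced_paths_push[OF assms])
  finally show "\<nu> G arev ?u n \<le> 1 * \<nu> G arev ?w (n + 2)" by (simp add: \<nu>_eq)
qed

lemma \<nu>_dominated_reachable:
  assumes "u \<rightarrow>\<^sup>*\<^bsub>G\<^esub> w"
  shows "dominated (\<nu> G arev u) (\<nu> G arev w)"
  using assms
proof (induction rule: converse_reachable_induct)
  case base
  show ?case by (rule dominated_refl)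
next
  case (step x y)
  then obtain a where "a \<in> arcs G" "tail G a = x" "head G a = y"
    by (meson reachableE)
  with \<nu>_dominated_by_neighbour[of a] step.IH show ?case by (auto intro: dominated_trans)
qed

lemma \<nu>_ge_1: "v \<in> verts G \<Longrightarrow> \<nu> G arev v n \<ge> 1"
proof -
  assume "v \<in> verts G"
  then have "{[]} \<subseteq> reduced_paths v v n"
    by (auto simp: reduced_paths_def awalk_Nil_iff reduced_def)
  from card_mono[OF finite_reduced_paths this] show ?thesis by (simp add: \<nu>_eq)
qed

lemma routes_awalk:
  assumes "p \<in> routes e f n"
  shows "awalk (tail G e) p (head G f)" "reduced arev p"
  using reduced_awalk_iff_turns[OF routesD(1)[OF assms], of "tail G e" "head G f"] routesD[OF assms]
  by auto

lemma finite_routes: "finite (routes e f n)"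
proof (rule finite_subset)
  show "routes e f n \<subseteq> reduced_paths (tail G e) (head G f) (Suc n)"
    using routes_awalk by (auto simp: reduced_paths_def dest: routesD(5))
qed (rule finite_reduced_paths)

text \<open>
  Gluing along the common arc is injective because the length of the first route is known.
\<close>

lemma card_routes_join:
  "card (routes e f m) * card (routes f g n) \<le> card (routes e g (m + n))"
proof (rule card_mult_le_by_injection[where f = "\<lambda>(p, q). p @ tl q"])
  show "inj_on (\<lambda>(p, q). p @ tl q) (routes e f m \<times> routes f g n)"
  proof (rule inj_onI, clarify)
    fix p q p' q'
    assume *: "p \<in> routes e f m" "q \<in> routes f g n" "p' \<in> routes e f m" "q' \<in> routes f g n"
      and eq: "p @ tl q = p' @ tl q'"
    have "length p = length p'" using routesD(5) * by simp
    with eq have "p = p'" "tl q = tl q'" by simp_all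
    then show "p = p' \<and> q = q'" using routesD(2) * by metis
  qed
qed (auto intro: routes_join finite_routes)

lemma card_routes_rev: "card (routes e f n) \<le> card (routes (arev f) (arev e) n)"
proof (rule card_inj_on_le)
  show "inj_on (\<lambda>p. map arev (rev p)) (routes e f n)"
    by (rule inj_on_inverseI[where g = "\<lambda>p. map arev (rev p)"]) (simp add: rev_map)
qed (use routes_rev finite_routes in blast)+

lemma card_routes_le:
  assumes "f \<in> arcs G"
  shows "card (routes f f n) \<le> d ^ n"
proof -
  have "card (routes f f n) \<le> card (awalks_from (head G f) n)"
  proof (rule card_inj_on_le)
    show "inj_on tl (routes f f n)"
      by (rule inj_on_inverseI[where g = "(#) f"]) (use routesD(2) in simp)
    show "tl ` routes f f n \<subseteq> awalks_from (head G f) n"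
    proof
      fix q assume "q \<in> tl ` routes f f n"
      then obtain p where p: "p \<in> routes f f n" "q = tl p" by blast
      then have "p = f # q" using routesD(2) by blast
      with routes_awalk(1)[OF p(1)] routesD(5)[OF p(1)] show "q \<in> awalks_from (head G f) n"
        by (auto simp: awalks_from_def awalk_Cons_iff)
    qed
  qed (use finite_card_awalks_from assms in auto)
  also have "\<dots> \<le> d ^ n" using finite_card_awalks_from assms by auto
  finally show ?thesis .
qed

section \<open>Closed paths at a vertex and loops at an arc\<close>

definition loops_upto :: "'b \<Rightarrow> nat \<Rightarrow> nat" where
  "loops_upto f n = (\<Sum>k\<le>n. card (routes f f k))"

lemma mono_loops_upto: "m \<le> n \<Longrightarrow> loops_upto f m \<le> loops_upto f n"
  unfolding loops_upto_def by (rule sum_mono2) auto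

lemma loops_upto_ge_1: "f \<in> arcs G \<Longrightarrow> loops_upto f n \<ge> 1"
  using mono_loops_upto[of 0 n f] by (simp add: loops_upto_def routes_0)

lemma loops_upto_root_limit:
  assumes "f \<in> arcs G"
  shows "\<exists>L::real. (\<lambda>n. root n (loops_upto f n)) \<longlonglongrightarrow> L"
  unfolding loops_upto_def
  by (rule supermultiplicative_sum_root_limit[where a = "\<lambda>k. card (routes f f k)" and D = d])
    (use assms in \<open>simp_all add: routes_0 card_routes_join card_routes_le\<close>)

text \<open>
  Fixed connecting routes from \<open>f\<close> to \<open>f'\<close> and from \<open>f''\<close> back to \<open>f\<close> extend each route from \<open>f'\<close>
  to \<open>f''\<close> to a loop at \<open>f\<close>. The existence of the connections is assumed conditionally because for
  some pairs of arcs it is derived, by \<open>turns_can_reverse_back\<close>, from that of a route between them.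
\<close>

lemma sum_routes_le_loops_upto:
  assumes "f \<in> arcs G" "f'' \<in> arcs G"
    and to: "turn\<^sup>*\<^sup>* f' f'' \<Longrightarrow> turn\<^sup>*\<^sup>* f f'" and fro: "turn\<^sup>*\<^sup>* f' f'' \<Longrightarrow> turn\<^sup>*\<^sup>* f'' f"
  shows "\<exists>K. \<forall>n. (\<Sum>k\<le>n. card (routes f' f'' k)) \<le> loops_upto f (n + K)"
proof (cases "\<exists>k. routes f' f'' k \<noteq> {}")
  case False
  then show ?thesis by simp
next
  case True
  then obtain p k where p: "p \<in> routes f' f'' k" by blast
  then have reach: "turn\<^sup>*\<^sup>* f' f''" by (rule routes_reachable)
  have "f' \<in> arcs G" using routesD(1,3,6)[OF p] hd_in_set[of p] by auto
  then obtain i where i: "routes f f' i \<noteq> {}" using to[OF reach] reachable_routes by blast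
  obtain j where j: "routes f'' f j \<noteq> {}" using fro[OF reach] assms(1) reachable_routes by blast
  have "card (routes f f' i) \<ge> 1" "card (routes f'' f j) \<ge> 1"
    using i j finite_routes by (simp_all add: Suc_le_eq card_gt_0_iff)
  have shift: "card (routes f' f'' k) \<le> card (routes f f (k + (i + j)))" for k
  proof -
    have "card (routes f' f'' k) \<le> card (routes f f' i) * card (routes f' f'' k)"
      using \<open>card (routes f f' i) \<ge> 1\<close> by simp
    also have "\<dots> \<le> card (routes f f'' (i + k))" by (rule card_routes_join)
    also have "\<dots> \<le> card (routes f f'' (i + k)) * card (routes f'' f j)"
      using \<open>card (routes f'' f j) \<ge> 1\<close> by simp
    also have "\<dots> \<le> card (routes f f (i + k + j))" by (rule card_routes_join)
    finally show ?thesis by (simp add: ac_simps)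
  qed
  have "(\<Sum>k\<le>n. card (routes f' f'' k)) \<le> loops_upto f (n + (i + j))" for n
  proof -
    have "(\<Sum>k\<le>n. card (routes f' f'' k)) \<le> (\<Sum>k\<le>n. card (routes f f (k + (i + j))))"
      by (rule sum_mono[OF shift])
    also have "\<dots> = (\<Sum>k\<in>(\<lambda>k. k + (i + j)) ` {..n}. card (routes f f k))"
      by (simp add: sum.reindex)
    also have "\<dots> \<le> loops_upto f (n + (i + j))"
      unfolding loops_upto_def by (rule sum_mono2) auto
    finally show ?thesis .
  qed
  then show ?thesis by blast
qed

text \<open>
  Dropping the first arc of a loop at \<open>f\<close> leaves a reduced closed path at the head of \<open>f\<close>.
\<close>

lemma loops_upto_dominated_by_\<nu>:
  assumes "f \<in> arcs G"
  shows "dominated (loops_upto f) (\<nu> G arev (head G f))"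
proof (rule dominatedI)
  fix n
  have "loops_upto f n = card (\<Union>k\<le>n. routes f f k)"
    unfolding loops_upto_def
    using finite_routes
    by (intro card_UN_disjoint[symmetric]) (simp_all add: routes_def, auto)
  also have "\<dots> \<le> card (reduced_paths (head G f) (head G f) n)"
  proof (rule card_inj_on_le)
    show "inj_on tl (\<Union>k\<le>n. routes f f k)"
      by (rule inj_on_inverseI[where g = "(#) f"]) (metis UN_E routesD(2))
    show "tl ` (\<Union>k\<le>n. routes f f k) \<subseteq> reduced_paths (head G f) (head G f) n"
    proof
      fix q assume "q \<in> tl ` (\<Union>k\<le>n. routes f f k)"
      then obtain p k where p: "k \<le> n" "p \<in> routes f f k" "q = tl p" by blast
      then have "p = f # q" using routesD(2) by blast
      with routes_awalk[OF p(2)] routesD(5)[OF p(2)] p(1)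
      show "q \<in> reduced_paths (head G f) (head G f) n"
        by (auto simp: reduced_paths_def awalk_Cons_iff reduced_iff_successively successively_Cons)
    qed
  qed (rule finite_reduced_paths)
  finally show "loops_upto f n \<le> 1 * \<nu> G arev (head G f) (n + 0)" by (simp add: \<nu>_eq)
qed

text \<open>
  Let \<open>e\<close> and \<open>f\<close> be the first and last arc of a closed path that may be repeated without
  backtracking. As \<open>arev f\<close> and \<open>e\<close> are distinct, the first arc of any reduced path starting at
  the same vertex differs from one of them, so the path may be preceded by \<open>f\<close> or by \<open>arev e\<close>;
  dually at its end.
\<close>

lemma reduced_closed_path_extends:
  assumes fe: "turn f e" and p: "p \<in> reduced_paths (tail G e) (tail G e) n" "p \<noteq> []"
  shows "\<exists>f' \<in> {f, arev e}. \<exists>e' \<in> {e, arev f}. f' # p @ [e'] \<in> routes f' e' (Suc (length p))"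
proof -
  have q: "set p \<subseteq> arcs G" "successively turn p" "tail G (hd p) = tail G e"
    "head G (last p) = tail G e"
    using p reduced_awalk_iff_turns[OF p(2)] by (auto simp: reduced_paths_def)
  have arcs: "hd p \<in> arcs G" "last p \<in> arcs G" "e \<in> arcs G" "f \<in> arcs G"
    using q(1) p(2) fe by (auto simp: turn_def)
  have "head G f = tail G e" "e \<noteq> arev f" using fe by (simp_all add: turn_def)
  have "\<exists>f' \<in> {f, arev e}. turn f' (hd p)"
  proof (cases "hd p = arev f")
    case True
    with \<open>e \<noteq> arev f\<close> have "hd p \<noteq> arev (arev e)" by simp
    with arcs q(3) have "turn (arev e) (hd p)" by (simp add: turn_def)
    then show ?thesis by blast
  next
    case False
    with arcs q(3) \<open>head G f = tail G e\<close> have "turn f (hd p)" by (simp add: turn_def)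
    then show ?thesis by blast
  qed
  then obtain f' where f': "f' \<in> {f, arev e}" "turn f' (hd p)" by blast
  have "\<exists>e' \<in> {e, arev f}. turn (last p) e'"
  proof (cases "last p = f")
    case True
    with arcs q(4) \<open>e \<noteq> arev f\<close> have "turn (last p) e" by (simp add: turn_def)
    then show ?thesis by blast
  next
    case False
    then have "arev f \<noteq> arev (last p)" by (metis arev_arev)
    with arcs q(4) \<open>head G f = tail G e\<close> have "turn (last p) (arev f)"
      by (simp add: turn_def)
    then show ?thesis by blast
  qed
  then obtain e' where e': "e' \<in> {e, arev f}" "turn (last p) e'" by blast
  have "f' \<in> arcs G" "e' \<in> arcs G" using f'(2) e'(2) by (auto simp: turn_def)
  with q p(2) f'(2) e'(2) have "f' # p @ [e'] \<in> routes f' e' (Suc (length p))"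
    by (auto simp: routes_def successively_Cons successively_append_iff)
  with f'(1) e'(1) show ?thesis by blast
qed

text \<open>
  Extending by one arc at either end maps the nonempty reduced closed paths to routes of four
  types. Those from \<open>f\<close> to \<open>e\<close> are completed to loops at \<open>f\<close> by the closed path through \<open>e\<close> and
  \<open>f\<close>, and those from \<open>arev e\<close> to \<open>arev f\<close> are their inverses. A route of a mixed type, from \<open>f\<close> to
  \<open>arev f\<close> or from \<open>arev e\<close> to \<open>e\<close>, reverses the direction of that closed path, and
  \<open>turns_can_reverse_back\<close> supplies a way to reverse it again.
\<close>

lemma \<nu>_dominated_by_loops_upto:
  assumes fe: "turn f e" and ef: "turn\<^sup>*\<^sup>* e f"
  shows "dominated (\<nu> G arev (tail G e)) (loops_upto f)"
proof -
  have arcs: "e \<in> arcs G" "f \<in> arcs G" using fe by (auto simp: turn_def)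
  let ?S = "\<lambda>f' e' n. \<Sum>k\<le>n. card (routes f' e' k)"
  have recf: "turn\<^sup>+\<^sup>+ f f" using fe ef by auto
  have rece': "turn\<^sup>+\<^sup>+ (arev e) (arev e)"
    using turn_arev[OF fe] turns_arev[OF ef] by (rule rtranclp_into_tranclp2)
  have "\<exists>K. \<forall>n. ?S f e n \<le> loops_upto f (n + K)"
    using sum_routes_le_loops_upto[of f e f] arcs ef by blast
  moreover have "\<exists>K. \<forall>n. ?S f (arev f) n \<le> loops_upto f (n + K)"
    using sum_routes_le_loops_upto[of f "arev f" f] arcs turns_can_reverse_back[OF recf] by auto
  moreover have "\<exists>K. \<forall>n. ?S (arev e) e n \<le> loops_upto f (n + K)"
  proof (rule sum_routes_le_loops_upto)
    assume "turn\<^sup>*\<^sup>* (arev e) e"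
    then have "turn\<^sup>*\<^sup>* e (arev e)" using turns_can_reverse_back[OF rece'] by simp
    with fe show "turn\<^sup>*\<^sup>* f (arev e)" by (rule converse_rtranclp_into_rtranclp)
  qed (use arcs ef in auto)
  ultimately obtain K1 K2 K3 where
    K: "\<And>n. ?S f e n \<le> loops_upto f (n + K1)"
      "\<And>n. ?S f (arev f) n \<le> loops_upto f (n + K2)"
      "\<And>n. ?S (arev e) e n \<le> loops_upto f (n + K3)"
    by blast
  define K where "K = K1 + K2 + K3"
  have S: "?S f e n \<le> loops_upto f (n + K)" "?S f (arev f) n \<le> loops_upto f (n + K)"
    "?S (arev e) e n \<le> loops_upto f (n + K)" for n
    by (rule order_trans[OF K(1) mono_loops_upto] order_trans[OF K(2) mono_loops_upto]
      order_trans[OF K(3) mono_loops_upto]; simp add: K_def)+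
  have "?S (arev e) (arev f) n \<le> ?S f e n" for n
    using card_routes_rev[of "arev e" "arev f"] by (intro sum_mono) simp
  then have S4: "?S (arev e) (arev f) n \<le> loops_upto f (n + K)" for n
    using S(1) by (rule order_trans)
  have SK: "?S f' e' n \<le> loops_upto f (n + K)" if "f' \<in> {f, arev e}" "e' \<in> {e, arev f}" for f' e' n
    using that by (elim insertE emptyE) (simp_all only: S S4)
  \<comment> \<open>Four types of routes, and one more for the trivial path; a path of length \<open>k\<close> extends to a
      route with \<open>k + 1\<close> turns.\<close>
  have "\<nu> G arev (tail G e) n \<le> 5 * loops_upto f (n + (1 + K))" for n
  proof -
    let ?I = "{f, arev e} \<times> {e, arev f} \<times> {..Suc n}"
    let ?R = "\<lambda>(f', e', k). (\<lambda>q. butlast (tl q)) ` routes f' e' k"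
    have "reduced_paths (tail G e) (tail G e) n \<subseteq> insert [] (\<Union>i\<in>?I. ?R i)"
    proof
      fix p assume p: "p \<in> reduced_paths (tail G e) (tail G e) n"
      show "p \<in> insert [] (\<Union>i\<in>?I. ?R i)"
      proof (cases "p = []")
        case False
        from reduced_closed_path_extends[OF fe p False] obtain f' e' where
          f'e': "f' \<in> {f, arev e}" "e' \<in> {e, arev f}"
            "f' # p @ [e'] \<in> routes f' e' (Suc (length p))"
          by blast
        have "p = butlast (tl (f' # p @ [e']))" by simp
        then have "p \<in> ?R (f', e', Suc (length p))"
          using f'e'(3) unfolding prod.case by (rule image_eqI)
        moreover have "(f', e', Suc (length p)) \<in> ?I"
          using f'e' p by (auto simp: reduced_paths_def)
        ultimately show ?thesis by blast
      qed simp
    qed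
    then have "card (reduced_paths (tail G e) (tail G e) n) \<le> card (insert [] (\<Union>i\<in>?I. ?R i))"
      by (rule card_mono[rotated]) (auto simp: finite_routes)
    also have "\<dots> \<le> Suc (card (\<Union>i\<in>?I. ?R i))" by (rule card_insert_le_m1) auto
    also have "card (\<Union>i\<in>?I. ?R i) \<le> (\<Sum>i\<in>?I. card (?R i))"
      by (rule card_UN_le) simp
    also have "\<dots> \<le> (\<Sum>(f', e', k)\<in>?I. card (routes f' e' k))"
      by (rule sum_mono) (auto intro: card_image_le finite_routes)
    also have "\<dots> = (\<Sum>f'\<in>{f, arev e}. \<Sum>e'\<in>{e, arev f}. ?S f' e' (Suc n))"
      by (simp only: sum.cartesian_product)
    also have "\<dots> \<le> (\<Sum>f'\<in>{f, arev e}. \<Sum>e'\<in>{e, arev f}. loops_upto f (Suc n + K))"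
      by (intro sum_mono SK)
    also have "\<dots> = card {f, arev e} * card {e, arev f} * loops_upto f (Suc n + K)"
      by simp
    also have "\<dots> \<le> 2 * 2 * loops_upto f (Suc n + K)"
      by (intro mult_le_mono) (auto simp: card_insert_if)
    finally show ?thesis
      using loops_upto_ge_1[OF arcs(2), of "Suc n + K"] by (simp add: \<nu>_eq)
  qed
  then show ?thesis by (rule dominatedI)
qed

section \<open>Existence of the limit and change of base vertex\<close>

text \<open>
  A closed path whose last arc is the inverse of its first one is a conjugate of a shorter closed
  path based at the next vertex. Stripping such pairs of arcs ends at a cyclically reduced path.
\<close>

lemma cyclically_reduced_loop_reachable:
  assumes "awalk v p v" "reduced arev p" "p \<noteq> []"
  shows "\<exists>e f. turn f e \<and> turn\<^sup>*\<^sup>* e f \<and> v \<rightarrow>\<^sup>*\<^bsub>G\<^esub> tail G e"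
  using assms
proof (induction "length p" arbitrary: v p rule: less_induct)
  case less
  define e f where "e = hd p" and "f = last p"
  have p: "set p \<subseteq> arcs G" "successively turn p" "tail G e = v" "head G f = v"
    using less.prems reduced_awalk_iff_turns[OF less.prems(3)] by (auto simp: e_def f_def)
  have arcs: "e \<in> arcs G" "f \<in> arcs G" using p(1) less.prems(3) by (auto simp: e_def f_def)
  show ?case
  proof (cases "e = arev f")
    case False
    have "p \<in> routes e f (length p - 1)"
      using p less.prems(3) by (simp add: routes_def e_def f_def)
    then have "turn\<^sup>*\<^sup>* e f" by (rule routes_reachable)
    moreover have "turn f e" using False arcs p by (simp add: turn_def)
    moreover have "v \<rightarrow>\<^sup>*\<^bsub>G\<^esub> tail G e" using p(3) arcs by auto
    ultimately show ?thesis by blast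
  next
    case True
    then have "e \<noteq> f" using arev_neq[OF arcs(2)] by simp
    obtain p' where p': "p = e # p'" using less.prems(3) by (cases p) (auto simp: e_def)
    with \<open>e \<noteq> f\<close> have "p' \<noteq> []" by (auto simp: f_def)
    then obtain q where "p' = q @ [f]" using p' by (cases p' rule: rev_cases) (auto simp: f_def)
    then have pq: "p = e # q @ [f]" using p' by simp
    have "f = arev e" using True by simp
    \<comment> \<open>The path \<open>[e, arev e]\<close> is not reduced.\<close>
    have "q \<noteq> []" using p(2) pq \<open>f = arev e\<close> by (auto simp: turn_def)
    have q: "set q \<subseteq> arcs G" "successively turn q" "turn e (hd q)" "turn (last q) f"
      using p(1,2) \<open>q \<noteq> []\<close> by (auto simp: pq successively_Cons successively_append_iff)
    have "tail G (hd q) = head G e" using q(3) by (simp add: turn_def)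
    moreover have "head G (last q) = head G e"
      using q(4) \<open>f = arev e\<close> arcs(1) by (simp add: turn_def)
    ultimately have "awalk (head G e) q (head G e)" "reduced arev q"
      using reduced_awalk_iff_turns[OF \<open>q \<noteq> []\<close>] q(1,2) by blast+
    with less.hyps[of q "head G e"] \<open>q \<noteq> []\<close> pq obtain e' f' where
      ef: "turn f' e'" "turn\<^sup>*\<^sup>* e' f'" "head G e \<rightarrow>\<^sup>*\<^bsub>G\<^esub> tail G e'"
      by auto
    have "v \<rightarrow>\<^bsub>G\<^esub> head G e" using arcs(1) p(3) in_arcs_imp_in_arcs_ends by blast
    with ef(3) have "v \<rightarrow>\<^sup>*\<^bsub>G\<^esub> tail G e'" by (rule adj_reachable_trans[rotated])
    with ef show ?thesis by blast
  qed
qed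

lemma \<nu>_mutually_dominated:
  assumes "u \<rightarrow>\<^sup>*\<^bsub>G\<^esub> w"
  shows "dominated (\<nu> G arev u) (\<nu> G arev w)" "dominated (\<nu> G arev w) (\<nu> G arev u)"
  using assms symmetric_reachable[OF sym_arcs] by (auto intro: \<nu>_dominated_reachable)

text \<open>
  If the trivial path is the only reduced closed path at \<open>v\<close>, the limit is \<open>1\<close>. Otherwise \<open>\<nu>\<close> grows
  like the number of loops at an arc of a cyclically reduced path.
\<close>

lemma \<nu>_root_limit:
  assumes "v \<in> verts G"
  shows "\<exists>L::real. (\<lambda>n. root n (\<nu> G arev v n)) \<longlonglongrightarrow> L"
proof (cases "\<exists>p. awalk v p v \<and> reduced arev p \<and> p \<noteq> []")
  case False
  then have "reduced_paths v v n = {[]}" for n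
    using assms by (auto simp: reduced_paths_def awalk_Nil_iff reduced_def)
  then have "\<nu> G arev v n = 1" for n by (simp add: \<nu>_eq)
  then show ?thesis using LIMSEQ_root_const[of 1] by auto
next
  case True
  then obtain e f where ef: "turn f e" "turn\<^sup>*\<^sup>* e f" and reach: "v \<rightarrow>\<^sup>*\<^bsub>G\<^esub> tail G e"
    using cyclically_reduced_loop_reachable by blast
  have f: "f \<in> arcs G" "head G f = tail G e" using ef(1) by (simp_all add: turn_def)
  obtain L where "(\<lambda>n. root n (loops_upto f n)) \<longlonglongrightarrow> L"
    using loops_upto_root_limit[OF f(1)] by blast
  moreover have "dominated (\<nu> G arev v) (loops_upto f)"
    using \<nu>_mutually_dominated(1)[OF reach] \<nu>_dominated_by_loops_upto[OF ef]
    by (rule dominated_trans)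
  moreover have "dominated (loops_upto f) (\<nu> G arev v)"
    using loops_upto_dominated_by_\<nu>[OF f(1)] \<nu>_mutually_dominated(2)[OF reach]
    unfolding f(2) by (rule dominated_trans)
  ultimately show ?thesis
    using root_limit_transfer loops_upto_ge_1[OF f(1)] by blast
qed

end

theorem lemma1p6:
  fixes G :: "('a, 'b) pre_digraph" and arev :: "'b \<Rightarrow> 'b" and v :: 'a
  assumes "bidirected_digraph G arev"
    and "bounded_degrees G"
    and "v \<in> verts G"
  shows "\<exists>L::real.
    (\<lambda>n. root n (real (\<nu> G arev v n))) \<longlonglongrightarrow> L \<and>
    (connected G \<longrightarrow>
      (\<forall>w \<in> verts G. (\<lambda>n. root n (real (\<nu> G arev w n))) \<longlonglongrightarrow> L))"
proof -
  obtain d where d: "\<And>u. u \<in> verts G \<Longrightarrow> finite (out_arcs G u) \<and> out_degree G u \<le> d"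
    using assms(2) unfolding bounded_degrees_def by blast
  interpret bidirected_digraph G arev by (rule assms(1))
  interpret bounded_bidirected_digraph G arev d
    by unfold_locales (use d in \<open>auto simp: out_degree_def\<close>)
  obtain L where L: "(\<lambda>n. root n (\<nu> G arev v n)) \<longlonglongrightarrow> L"
    using \<nu>_root_limit[OF assms(3)] by blast
  have "(\<lambda>n. root n (\<nu> G arev w n)) \<longlonglongrightarrow> L" if "connected G" "w \<in> verts G" for w
  proof -
    have "strongly_connected G"
      using symmetric_connected_imp_strongly_connected[OF sym_arcs that(1)] .
    then have "v \<rightarrow>\<^sup>*\<^bsub>G\<^esub> w" using assms(3) that(2) by (auto simp: strongly_connected_def)
    from \<nu>_mutually_dominated[OF this] show ?thesis
      by (intro root_limit_transfer[OF L \<nu>_ge_1[OF assms(3)]])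
  qed
  with L show ?thesis by blast
qed

end
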